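(* Let $\mathbb{K}$ be a field of characteristic zero. For every positive integer $n$, $\beta(\mathcal{I}_n)\ge\left\lfloor\frac n2\right\rfloor$.
   Context: Let $\mathbb{K}[x_{\{i,j\}}]$ be the polynomial ring in $\binom n2$ variables indexed by the pairs $\{i,j\}$, $1\le i<j\le n$. The symmetric group $\mathfrak{S}_n$ acts on it by $\sigma\cdot x_{\{i,j\}}=x_{\{\sigma(i),\sigma(j)\}}$, and $\mathcal{I}_n:=\mathbb{K}[x_{\{i,j\}}]^{\mathfrak{S}_n}$. $\beta(\mathcal{I}_n)$ denotes the smallest integer $d$ such that $\mathcal{I}_n$ is generated as a $\mathbb{K}$-algebra by its invariants of degree at most $d$. *)

theory Defs
  imports Complex_Main "HOL-Library.Poly_Mapping" "HOL-Combinatorics.Permutations"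
begin

text \<open>A monomial maps each variable to its exponent and a polynomial maps each monomial to its
  coefficient; multiplication of poly mappings is convolution, i.e. multiplication of polynomials.\<close>

type_synonym 'v monomial = "'v \<Rightarrow>\<^sub>0 nat"
type_synonym ('v, 'k) mpoly = "'v monomial \<Rightarrow>\<^sub>0 'k"

definition var :: "'v \<Rightarrow> ('v, 'k :: comm_ring_1) mpoly" where
  "var x = Poly_Mapping.single (Poly_Mapping.single x 1) 1"

definition const :: "'k \<Rightarrow> ('v, 'k :: comm_ring_1) mpoly" where
  "const c = Poly_Mapping.single 0 c"

definition monomial_degree :: "'v monomial \<Rightarrow> nat" where
  "monomial_degree m = (\<Sum>x\<in>Poly_Mapping.keys m. Poly_Mapping.lookup m x)"

text \<open>The total degree; the zero polynomial gets degree 0.\<close>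

definition total_degree :: "('v, 'k :: comm_ring_1) mpoly \<Rightarrow> nat" where
  "total_degree p = Max (insert 0 (monomial_degree ` Poly_Mapping.keys p))"

definition polynomial_ring :: "'v set \<Rightarrow> ('v, 'k :: comm_ring_1) mpoly set" where
  "polynomial_ring V = {p. \<forall>m\<in>Poly_Mapping.keys p. Poly_Mapping.keys m \<subseteq> V}"

text \<open>The substitution of variables \<open>x \<mapsto> f x\<close>, extended to a homomorphism of algebras.\<close>

definition rename_monomial :: "('v \<Rightarrow> 'w) \<Rightarrow> 'v monomial \<Rightarrow> 'w monomial" where
  "rename_monomial f m =
    (\<Sum>x\<in>Poly_Mapping.keys m. Poly_Mapping.single (f x) (Poly_Mapping.lookup m x))"

definition rename_vars :: "('v \<Rightarrow> 'w) \<Rightarrow> ('v, 'k :: comm_ring_1) mpoly \<Rightarrow> ('w, 'k) mpoly" where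
  "rename_vars f p =
    (\<Sum>m\<in>Poly_Mapping.keys p. Poly_Mapping.single (rename_monomial f m) (Poly_Mapping.lookup p m))"

lemma rename_vars_var: "rename_vars f (var x) = var (f x)"
  by (simp add: rename_vars_def rename_monomial_def var_def)

text \<open>Unital subalgebras over the coefficient ring: they contain all constants, so that they are
  closed under scalar multiplication. The subalgebra generated by \<open>G\<close> is
  \<open>is_subalgebra hull G\<close>.\<close>

definition is_subalgebra :: "('v, 'k :: comm_ring_1) mpoly set \<Rightarrow> bool" where
  "is_subalgebra A \<longleftrightarrow> (\<forall>c. const c \<in> A) \<and>
     (\<forall>p\<in>A. \<forall>q\<in>A. p + q \<in> A) \<and> (\<forall>p\<in>A. \<forall>q\<in>A. p * q \<in> A)"

definition generated_in_degree :: "('v, 'k :: comm_ring_1) mpoly set \<Rightarrow> nat \<Rightarrow> bool" where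
  "generated_in_degree A d \<longleftrightarrow> is_subalgebra hull {p \<in> A. total_degree p \<le> d} = A"

definition beta :: "('v, 'k :: comm_ring_1) mpoly set \<Rightarrow> nat" where
  "beta A = (LEAST d. generated_in_degree A d)"

definition edges :: "nat \<Rightarrow> nat set set" where
  "edges n = {{i, j} | i j. 1 \<le> i \<and> i < j \<and> j \<le> n}"

definition act :: "(nat \<Rightarrow> nat) \<Rightarrow> (nat set, 'k :: comm_ring_1) mpoly \<Rightarrow> (nat set, 'k) mpoly" where
  "act \<sigma> = rename_vars (\<lambda>e. \<sigma> ` e)"

lemma act_var: "act \<sigma> (var {i, j}) = var {\<sigma> i, \<sigma> j}"
  by (simp add: act_def rename_vars_var)

definition graph_invariants :: "nat \<Rightarrow> (nat set, 'k :: comm_ring_1) mpoly set" where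
  "graph_invariants n =
    {p \<in> polynomial_ring (edges n). \<forall>\<sigma>. \<sigma> permutes {1..n} \<longrightarrow> act \<sigma> p = p}"

end

theory Submission
  imports "HOL-Algebra.Algebraic_Closure_Type" Defs
begin

text \<open>Noether's argument makes the ring of invariants generated in bounded degree, so that its
  \<open>beta\<close> is attained. For the lower bound, choose \<open>k = 2 ^ e\<close> with \<open>n div 2 \<le> k < n\<close> and a
  primitive \<open>k\<close>-th root of unity \<open>z\<close> in the algebraic closure; powers of two only ask for a root
  of \<open>- 1\<close>. Put the weights \<open>z, z\<^sup>2, \<dots>, z\<^sup>k\<close> on the edges of a star with \<open>k\<close> leaves and \<open>0\<close> on
  the other edges. Rotating the leaves multiplies this point by \<open>z\<close>, hence an invariant of degree
  less than \<open>k\<close> takes the same value there as at the origin, and so does everything generated by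
  such invariants. The power sum of degree \<open>k\<close> takes the values \<open>k\<close> and \<open>0\<close>.\<close>

subsection \<open>Polynomials as sums of monomials\<close>

lemma poly_mapping_sum_single:
  "(\<Sum>m\<in>Poly_Mapping.keys p. Poly_Mapping.single m (Poly_Mapping.lookup p m)) = p"
  by (rule poly_mapping_eqI)
    (auto simp: lookup_sum lookup_single when_def in_keys_iff sum.delta)

text \<open>The assumption covers \<open>c = 0\<close>, where \<open>single m c\<close> has no keys
  and the sum is empty. Degree, renaming and evaluation of polynomials are sums of this
  shape.\<close>

lemma sum_keys_single:
  assumes "f m 0 = 0"
  shows "(\<Sum>k\<in>Poly_Mapping.keys (Poly_Mapping.single m c). f k (Poly_Mapping.lookup (Poly_Mapping.single m c) k)) = f m c"
  using assms by (cases "c = 0") auto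

lemma additive_sum:
  fixes F :: "'a :: comm_monoid_add \<Rightarrow> 'b :: comm_monoid_add"
  assumes "\<And>p q. F (p + q) = F p + F q" "F 0 = 0"
  shows "F (sum f I) = (\<Sum>i\<in>I. F (f i))"
  by (induction I rule: infinite_finite_induct) (simp_all add: assms)

text \<open>Both sides are additive in \<open>p\<close> and in \<open>q\<close>, and every
  polynomial is the sum of its terms.\<close>

lemma multiplicative_if_on_singles:
  fixes F :: "('m :: comm_monoid_add \<Rightarrow>\<^sub>0 'k :: comm_semiring_1) \<Rightarrow> 'r :: comm_semiring_1"
  assumes add: "\<And>p q. F (p + q) = F p + F q" and zero: "F 0 = 0"
    and single: "\<And>m c n d. F (Poly_Mapping.single (m + n) (c * d)) =
      F (Poly_Mapping.single m c) * F (Poly_Mapping.single n d)"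
  shows "F (p * q) = F p * F q"
proof -
  let ?s = "\<lambda>p m. Poly_Mapping.single m (Poly_Mapping.lookup p m)"
  have "F (p * q) = F ((\<Sum>m\<in>Poly_Mapping.keys p. ?s p m) * (\<Sum>n\<in>Poly_Mapping.keys q. ?s q n))"
    by (simp only: poly_mapping_sum_single)
  also have "\<dots> = (\<Sum>m\<in>Poly_Mapping.keys p. F (?s p m)) * (\<Sum>n\<in>Poly_Mapping.keys q. F (?s q n))"
    by (simp add: sum_product mult_single additive_sum[of F, OF add zero] single)
  also have "\<dots> = F p * F q"
    by (simp add: additive_sum[of F, OF add zero, symmetric] poly_mapping_sum_single)
  finally show ?thesis .
qed

lemma prod_var:
  "finite S \<Longrightarrow> (\<Prod>h\<in>S. var (w h)) =
    Poly_Mapping.single (\<Sum>h\<in>S. Poly_Mapping.single (w h) 1) (1 :: 'k :: comm_ring_1)"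
  by (induction S rule: finite_induct) (simp_all add: var_def mult_single)

subsection \<open>Degrees\<close>

lemma monomial_degree_add: "monomial_degree (m + n) = monomial_degree m + monomial_degree n"
  unfolding monomial_degree_def by (rule setsum_keys_plus_distrib[where f = "\<lambda>_ c. c"]) auto

lemma monomial_degree_zero [simp]: "monomial_degree 0 = 0"
  by (simp add: monomial_degree_def)

lemma monomial_degree_single [simp]: "monomial_degree (Poly_Mapping.single x c) = c"
  unfolding monomial_degree_def by (rule sum_keys_single[where f = "\<lambda>_ c. c"]) simp

lemma monomial_degree_sum: "monomial_degree (sum f I) = (\<Sum>i\<in>I. monomial_degree (f i))"
  by (rule additive_sum) (simp_all add: monomial_degree_add)

lemma total_degree_le_iff:
  "total_degree p \<le> d \<longleftrightarrow> (\<forall>m\<in>Poly_Mapping.keys p. monomial_degree m \<le> d)"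
  by (auto simp: total_degree_def)

text \<open>The factors are indexed by an arbitrary finite set because Noether's argument takes the
  group itself as \<open>I\<close>. Each induction step peels off one variable.\<close>

lemma exists_monomial_factor:
  assumes "finite I" "card I \<le> monomial_degree m"
  shows "\<exists>v r. m = (\<Sum>i\<in>I. Poly_Mapping.single (v i) 1) + r \<and> v ` I \<subseteq> Poly_Mapping.keys m
    \<and> Poly_Mapping.keys r \<subseteq> Poly_Mapping.keys m"
  using assms
proof (induction I arbitrary: m rule: finite_induct)
  case (insert i I)
  from insert have "Poly_Mapping.keys m \<noteq> {}"
    by (auto simp: monomial_degree_def)
  then obtain x where x: "x \<in> Poly_Mapping.keys m" by blast
  define m' where "m' = m - Poly_Mapping.single x 1"
  have m: "m = Poly_Mapping.single x 1 + m'"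
    using x by (intro poly_mapping_eqI)
      (auto simp: m'_def lookup_add lookup_minus lookup_single when_def in_keys_iff)
  have keys: "Poly_Mapping.keys m' \<subseteq> Poly_Mapping.keys m"
    by (auto simp: m'_def in_keys_iff lookup_minus)
  have "monomial_degree m = 1 + monomial_degree m'"
    by (subst m) (simp add: monomial_degree_add)
  with insert obtain v r where v: "m' = (\<Sum>i\<in>I. Poly_Mapping.single (v i) 1) + r"
    "v ` I \<subseteq> Poly_Mapping.keys m'" "Poly_Mapping.keys r \<subseteq> Poly_Mapping.keys m'"
    by (metis Suc_le_mono card_insert_disjoint plus_1_eq_Suc)
  have "(\<Sum>j\<in>I. Poly_Mapping.single ((v(i := x)) j) (1::nat)) = (\<Sum>i\<in>I. Poly_Mapping.single (v i) 1)"
    using insert by (intro sum.cong) auto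
  then show ?case
    using insert.hyps v x keys m
    by (intro exI[of _ "v(i := x)"] exI[of _ r]) (auto simp: add.assoc)
qed auto

subsection \<open>Renaming of variables\<close>

lemma rename_monomial_add:
  "rename_monomial f (m + n) = rename_monomial f m + rename_monomial f n"
  unfolding rename_monomial_def
  by (rule setsum_keys_plus_distrib[where f = "\<lambda>x c. Poly_Mapping.single (f x) c"])
    (auto simp: single_add)

lemma rename_monomial_zero [simp]: "rename_monomial f 0 = 0"
  by (simp add: rename_monomial_def)

lemma rename_monomial_single [simp]:
  "rename_monomial f (Poly_Mapping.single x c) = Poly_Mapping.single (f x) c"
  unfolding rename_monomial_def
  by (rule sum_keys_single[where f = "\<lambda>x c. Poly_Mapping.single (f x) c"]) simp

lemma rename_monomial_sum: "rename_monomial f (sum g I) = (\<Sum>i\<in>I. rename_monomial f (g i))"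
  by (rule additive_sum) (simp_all add: rename_monomial_add)

lemma rename_monomial_comp: "rename_monomial f (rename_monomial g m) = rename_monomial (f \<circ> g) m"
  unfolding rename_monomial_def[of g] rename_monomial_def[of "f \<circ> g"] rename_monomial_sum by simp

lemma monomial_degree_rename [simp]: "monomial_degree (rename_monomial f m) = monomial_degree m"
  by (simp add: rename_monomial_def monomial_degree_sum) (simp add: monomial_degree_def)

lemma keys_rename_monomial: "Poly_Mapping.keys (rename_monomial f m) \<subseteq> f ` Poly_Mapping.keys m"
  unfolding rename_monomial_def by (rule order_trans[OF keys_sum]) auto

lemma rename_vars_add: "rename_vars f (p + q) = rename_vars f p + rename_vars f q"
  unfolding rename_vars_def
  by (rule setsum_keys_plus_distrib[where f = "\<lambda>m c. Poly_Mapping.single (rename_monomial f m) c"])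
    (auto simp: single_add)

lemma rename_vars_zero [simp]: "rename_vars f 0 = 0"
  by (simp add: rename_vars_def)

lemma rename_vars_single [simp]:
  "rename_vars f (Poly_Mapping.single m c) = Poly_Mapping.single (rename_monomial f m) c"
  unfolding rename_vars_def
  by (rule sum_keys_single[where f = "\<lambda>m c. Poly_Mapping.single (rename_monomial f m) c"]) simp

lemma rename_vars_sum: "rename_vars f (sum g I) = (\<Sum>i\<in>I. rename_vars f (g i))"
  by (rule additive_sum) (simp_all add: rename_vars_add)

lemma rename_vars_mult: "rename_vars f (p * q) = rename_vars f p * rename_vars f q"
  by (rule multiplicative_if_on_singles)
    (simp_all add: rename_vars_add rename_monomial_add mult_single)

lemma rename_vars_const [simp]: "rename_vars f (const c) = const c"
  by (simp add: const_def)

lemma rename_vars_one [simp]: "rename_vars f 1 = 1"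
  using rename_vars_const[of f 1] by (simp add: const_def)

lemma rename_vars_power: "rename_vars f (p ^ k) = rename_vars f p ^ k"
  by (induction k) (simp_all add: rename_vars_mult)

lemma rename_vars_prod: "rename_vars f (prod g I) = (\<Prod>i\<in>I. rename_vars f (g i))"
  by (induction I rule: infinite_finite_induct) (simp_all add: rename_vars_mult)

lemma rename_vars_comp: "rename_vars f (rename_vars g p) = rename_vars (f \<circ> g) p"
  unfolding rename_vars_def[of g] rename_vars_def[of "f \<circ> g"] rename_vars_sum
  by (simp add: rename_monomial_comp)

subsection \<open>Subalgebras\<close>

lemma const_in_subalgebra: "is_subalgebra A \<Longrightarrow> const c \<in> A"
  and add_in_subalgebra: "is_subalgebra A \<Longrightarrow> p \<in> A \<Longrightarrow> q \<in> A \<Longrightarrow> p + q \<in> A"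
  and mult_in_subalgebra: "is_subalgebra A \<Longrightarrow> p \<in> A \<Longrightarrow> q \<in> A \<Longrightarrow> p * q \<in> A"
  by (auto simp: is_subalgebra_def)

lemma const_zero: "const 0 = 0"
  and const_one: "const 1 = 1"
  and const_uminus: "const (- c) = - const c"
  and const_mult: "const (c * d) = const c * const d"
  by (simp_all add: const_def mult_single single_uminus)

lemma const_of_nat: "const (of_nat k) = of_nat k"
  by (simp add: const_def)

lemma sum_in_subalgebra:
  "is_subalgebra A \<Longrightarrow> (\<And>i. i \<in> I \<Longrightarrow> f i \<in> A) \<Longrightarrow> sum f I \<in> A"
  using const_in_subalgebra[of A 0] add_in_subalgebra[of A]
  by (induction I rule: infinite_finite_induct) (auto simp: const_zero)

lemma power_in_subalgebra: "is_subalgebra A \<Longrightarrow> p \<in> A \<Longrightarrow> p ^ k \<in> A"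
  using const_in_subalgebra[of A 1] mult_in_subalgebra[of A]
  by (induction k) (auto simp: const_one)

lemma is_subalgebra_hull: "is_subalgebra (is_subalgebra hull S)"
  by (rule hull_in) (auto simp: is_subalgebra_def)

lemma is_subalgebra_polynomial_ring:
  "is_subalgebra (polynomial_ring V :: ('v, 'k :: comm_ring_1) mpoly set)"
  unfolding is_subalgebra_def polynomial_ring_def
proof (intro conjI ballI allI; clarsimp)
  fix c :: 'k and m :: "'v monomial" and x assume "m \<in> Poly_Mapping.keys (const c)" "x \<in> Poly_Mapping.keys m"
  then show "x \<in> V" by (auto simp: const_def split: if_splits)
next
  fix p q :: "('v, 'k) mpoly" and m :: "'v monomial" and x
  assume "\<forall>m\<in>Poly_Mapping.keys p. Poly_Mapping.keys m \<subseteq> V"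
    "\<forall>m\<in>Poly_Mapping.keys q. Poly_Mapping.keys m \<subseteq> V"
    "m \<in> Poly_Mapping.keys (p + q)" "x \<in> Poly_Mapping.keys m"
  then show "x \<in> V" using keys_add[of p q] by blast
next
  fix p q :: "('v, 'k) mpoly" and m :: "'v monomial" and x
  assume *: "\<forall>m\<in>Poly_Mapping.keys p. Poly_Mapping.keys m \<subseteq> V"
    "\<forall>m\<in>Poly_Mapping.keys q. Poly_Mapping.keys m \<subseteq> V"
    "m \<in> Poly_Mapping.keys (p * q)" "x \<in> Poly_Mapping.keys m"
  then obtain a b where "m = a + b" "a \<in> Poly_Mapping.keys p" "b \<in> Poly_Mapping.keys q"
    using keys_mult[of p q] by blast
  with * show "x \<in> V" using keys_add[of a b] by blast
qed

lemma var_in_polynomial_ring: "x \<in> V \<Longrightarrow> var x \<in> polynomial_ring V"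
  by (auto simp: polynomial_ring_def var_def split: if_splits)

text \<open>The general setting of Noether's bound; for \<open>graph_invariants\<close>,
  \<open>G\<close> consists of the maps on edges induced by permutations of the vertices.\<close>

definition invariants ::
    "'v set \<Rightarrow> ('v \<Rightarrow> 'v) set \<Rightarrow> ('v, 'k :: comm_ring_1) mpoly set" where
  "invariants V G = {p \<in> polynomial_ring V. \<forall>g\<in>G. rename_vars g p = p}"

lemma is_subalgebra_invariants: "is_subalgebra (invariants V G)"
  using is_subalgebra_polynomial_ring[of V]
  by (auto simp: is_subalgebra_def invariants_def rename_vars_add rename_vars_mult)

subsection \<open>Noether's bound\<close>

text \<open>The Reynolds operator without the factor \<open>1 / card G\<close>.\<close>

definition transfer :: "('v \<Rightarrow> 'v) set \<Rightarrow> ('v, 'k :: comm_ring_1) mpoly \<Rightarrow> ('v, 'k) mpoly" where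
  "transfer G p = (\<Sum>g\<in>G. rename_vars g p)"

lemma transfer_add: "transfer G (p + q) = transfer G p + transfer G q"
  by (simp add: transfer_def rename_vars_add sum.distrib)

lemma transfer_zero [simp]: "transfer G 0 = 0"
  by (simp add: transfer_def)

lemma transfer_sum: "transfer G (sum f I) = (\<Sum>i\<in>I. transfer G (f i))"
  by (rule additive_sum) (simp_all add: transfer_add)

lemma transfer_mult_invariant:
  "(\<And>g. g \<in> G \<Longrightarrow> rename_vars g p = p) \<Longrightarrow> transfer G (p * q) = p * transfer G q"
  by (simp add: transfer_def rename_vars_mult sum_distrib_left)

lemma transfer_of_invariant:
  "(\<And>g. g \<in> G \<Longrightarrow> rename_vars g p = p) \<Longrightarrow> transfer G p = const (of_nat (card G)) * p"
  by (simp add: transfer_def const_of_nat)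

lemma total_degree_transfer_single:
  "total_degree (transfer G (Poly_Mapping.single m c)) \<le> monomial_degree m"
  unfolding total_degree_le_iff transfer_def
  using keys_sum[of "\<lambda>g. rename_vars g (Poly_Mapping.single m c)" G]
  by (force split: if_splits)

locale finite_substitution_group =
  fixes V :: "'v set" and G :: "('v \<Rightarrow> 'v) set"
  assumes finite_G: "finite G"
    and id_in_G: "id \<in> G"
    and comp_in_G: "g \<in> G \<Longrightarrow> h \<in> G \<Longrightarrow> g \<circ> h \<in> G"
    and right_inverse: "g \<in> G \<Longrightarrow> \<exists>h\<in>G. g \<circ> h = id"
    and stable: "g \<in> G \<Longrightarrow> x \<in> V \<Longrightarrow> g x \<in> V"
begin

lemma bij_betw_translation:
  assumes "g \<in> G" shows "bij_betw (\<lambda>h. g \<circ> h) G G"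
proof -
  obtain g' where g': "g' \<in> G" "g \<circ> g' = id" using right_inverse assms by blast
  have "h \<in> (\<lambda>h. g \<circ> h) ` G" if "h \<in> G" for h
  proof (rule image_eqI)
    show "h = g \<circ> (g' \<circ> h)" using g' by (simp flip: comp_assoc)
    show "g' \<circ> h \<in> G" using g' that comp_in_G by blast
  qed
  then have "(\<lambda>h. g \<circ> h) ` G = G" using assms comp_in_G by blast
  then show ?thesis using finite_G by (simp add: bij_betw_def eq_card_imp_inj_on)
qed

text \<open>Left translation by \<open>g\<close> is a bijection of the group, so it only permutes
  the summands.\<close>

lemma rename_vars_transfer:
  assumes "g \<in> G" shows "rename_vars g (transfer G p) = transfer G p"
  unfolding transfer_def rename_vars_sum rename_vars_comp
  by (rule sum.reindex_bij_betw[OF bij_betw_translation[OF assms], where g = "\<lambda>h. rename_vars h p"])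

lemma rename_in_polynomial_ring:
  assumes "g \<in> G" "Poly_Mapping.keys m \<subseteq> V"
  shows "Poly_Mapping.single (rename_monomial g m) c \<in> polynomial_ring V"
  using keys_rename_monomial[of g m] assms stable
  by (fastforce simp: polynomial_ring_def split: if_splits)

lemma transfer_single_in_invariants:
  assumes "Poly_Mapping.keys m \<subseteq> V"
  shows "transfer G (Poly_Mapping.single m c) \<in> invariants V G"
  unfolding invariants_def
  using assms rename_in_polynomial_ring
  by (auto simp: rename_vars_transfer)
    (auto simp: transfer_def intro!: sum_in_subalgebra is_subalgebra_polynomial_ring)

text \<open>Fogarty's and Benson's identity: for every \<open>g\<close> the factor of
  \<open>\<Prod>h. (x\<^sub>h - g (h x\<^sub>h))\<close> at the inverse of \<open>g\<close> vanishes. Summing the expanded products over all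
  \<open>g\<close> exhibits a product of \<open>card G\<close> variables as a combination of transfers.\<close>

lemma noether_identity:
  fixes v :: "('v \<Rightarrow> 'v) \<Rightarrow> 'v"
  shows "const (of_nat (card G)) * (\<Prod>h\<in>G. var (v h)) =
    - (\<Sum>S\<in>Pow G - {{}}. (- 1) ^ card S * transfer G (\<Prod>h\<in>S. var (h (v h)))
        * (\<Prod>h\<in>G - S. var (v h)) :: ('v, 'k :: comm_ring_1) mpoly)"
proof -
  let ?t = "\<lambda>S. (- 1) ^ card S * transfer G (\<Prod>h\<in>S. var (h (v h)))
        * (\<Prod>h\<in>G - S. var (v h)) :: ('v, 'k) mpoly"
  have vanish: "(\<Prod>h\<in>G. var (v h) - var (g (h (v h)))) = (0 :: ('v, 'k) mpoly)" if g: "g \<in> G" for g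
  proof -
    obtain h where "h \<in> G" "g \<circ> h = id" using right_inverse g by blast
    then show ?thesis
      using finite_G by (intro prod_zero bexI[of _ h]) (auto simp: pointfree_idE)
  qed
  have "(\<Sum>S\<in>Pow G. ?t S) = (\<Sum>S\<in>Pow G. \<Sum>g\<in>G. (- 1) ^ card S * (\<Prod>h\<in>S. var (g (h (v h))))
      * (\<Prod>h\<in>G - S. var (v h)))"
    by (simp add: transfer_def rename_vars_prod rename_vars_var sum_distrib_left sum_distrib_right)
  \<comment> \<open>The subset expansion of a product of differences, read backwards:
    \<open>S\<close> collects the \<open>h\<close> whose subtracted term is chosen.\<close>
  also have "\<dots> = (\<Sum>g\<in>G. \<Prod>h\<in>G. var (v h) - var (g (h (v h))))"
    by (subst sum.swap) (simp add: prod_diff_conv_sum finite_G)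
  also have "\<dots> = 0" by (simp add: vanish)
  \<comment> \<open>The term of the empty set is the left-hand side of the claim, as the transfer of
    \<open>1\<close> is \<open>card G\<close>.\<close>
  finally have "?t {} + (\<Sum>S\<in>Pow G - {{}}. ?t S) = 0"
    using finite_G by (subst (asm) sum.remove[of _ "{}"]) auto
  then show ?thesis
    by (simp add: transfer_of_invariant[of G 1, simplified] eq_neg_iff_add_eq_0)
qed

text \<open>Induction on the degree. Above \<open>card G\<close>, split \<open>card G\<close>
  variables off \<open>m\<close> and multiply \<open>noether_identity\<close> by the rest
  \<open>r\<close>: the transfer of \<open>m\<close> becomes a combination of products of a transfer
  of degree at most \<open>card G\<close> and the transfer of a monomial of smaller degree than
  \<open>m\<close>.\<close>

lemma transfer_single_in_hull:
  assumes "Poly_Mapping.keys m \<subseteq> V"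
  shows "transfer G (Poly_Mapping.single m (1 :: 'k :: field_char_0)) \<in>
    is_subalgebra hull {p \<in> invariants V G. total_degree p \<le> card G}"
  using assms
proof (induction "monomial_degree m" arbitrary: m rule: less_induct)
  case less
  define A where "A = is_subalgebra hull
    {p \<in> (invariants V G :: ('v, 'k) mpoly set). total_degree p \<le> card G}"
  have A: "is_subalgebra A"
    unfolding A_def by (rule is_subalgebra_hull)
  have low: "transfer G (Poly_Mapping.single r 1) \<in> A"
    if "Poly_Mapping.keys r \<subseteq> V" "monomial_degree r \<le> card G" for r
    unfolding A_def using that order_trans[OF total_degree_transfer_single]
    by (intro hull_inc) (simp add: transfer_single_in_invariants)
  show ?case
  proof (cases "monomial_degree m \<le> card G")
    case True
    then show ?thesis using low less.prems by (simp add: A_def)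
  next
    case False
    then obtain v r where m: "m = (\<Sum>h\<in>G. Poly_Mapping.single (v h) 1) + r"
      and v: "v ` G \<subseteq> V" and r: "Poly_Mapping.keys r \<subseteq> V"
      using exists_monomial_factor[OF finite_G, of m] less.prems by fastforce
    let ?r = "Poly_Mapping.single r (1 :: 'k)"
    let ?P = "\<lambda>S. \<Prod>h\<in>S. var (h (v h)) :: ('v, 'k) mpoly"
    let ?Q = "\<lambda>S. (\<Prod>h\<in>G - S. var (v h)) * ?r"
    have P: "transfer G (?P S) \<in> A" if "S \<subseteq> G" for S
    proof -
      have S: "finite S" using that finite_G finite_subset by blast
      have "Poly_Mapping.keys (\<Sum>h\<in>S. Poly_Mapping.single (h (v h)) (1::nat)) \<subseteq> V"
        using that v stable by (intro order_trans[OF keys_sum]) (auto split: if_splits)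
      then show ?thesis
        unfolding prod_var[OF S] using that finite_G
        by (intro low) (simp_all add: monomial_degree_sum card_mono)
    qed
    \<comment> \<open>As \<open>S\<close> is nonempty, fewer than \<open>card G\<close> of the
      split-off variables remain, and the induction hypothesis applies.\<close>
    have Q: "transfer G (?Q S) \<in> A" if S: "S \<subseteq> G" "S \<noteq> {}" for S
    proof -
      let ?m = "(\<Sum>h\<in>G - S. Poly_Mapping.single (v h) 1) + r"
      have "card (G - S) < card G"
        using S finite_G by (intro psubset_card_mono) auto
      then have "monomial_degree ?m < monomial_degree m"
        by (simp add: m monomial_degree_add monomial_degree_sum)
      moreover have "Poly_Mapping.keys ?m \<subseteq> V"
        using v r keys_sum[of "\<lambda>h. Poly_Mapping.single (v h) (1::nat)" "G - S"]
        by (intro order_trans[OF keys_add]) (auto split: if_splits, blast)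
      ultimately have "transfer G (Poly_Mapping.single ?m (1 :: 'k)) \<in> A"
        using less.hyps unfolding A_def by blast
      then show ?thesis using finite_G by (simp add: prod_var mult_single)
    qed
    let ?c = "const (of_nat (card G)) :: ('v, 'k) mpoly"
    have "?c * Poly_Mapping.single m 1 = ?c * (\<Prod>h\<in>G. var (v h)) * ?r"
      by (simp add: m prod_var finite_G mult_single mult.assoc)
    also have "\<dots> = (\<Sum>S\<in>Pow G - {{}}. const (- ((- 1) ^ card S)) * (transfer G (?P S) * ?Q S))"
      unfolding noether_identity
      by (simp add: sum_distrib_right sum_negf mult.assoc const_uminus)
        (rule sum.cong, auto simp: const_def minus_one_power_iff single_uminus)
    \<comment> \<open>\<open>transfer G (?P S)\<close> is invariant, so it comes out of the outer
      transfer as a factor.\<close>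
    finally have "transfer G (?c * Poly_Mapping.single m 1) =
        (\<Sum>S\<in>Pow G - {{}}. const (- ((- 1) ^ card S)) * (transfer G (?P S) * transfer G (?Q S)))"
      by (simp add: transfer_sum transfer_mult_invariant rename_vars_transfer)
    then have "?c * transfer G (Poly_Mapping.single m 1) =
        (\<Sum>S\<in>Pow G - {{}}. const (- ((- 1) ^ card S)) * (transfer G (?P S) * transfer G (?Q S)))"
      by (simp add: transfer_mult_invariant)
    then have "?c * transfer G (Poly_Mapping.single m 1) \<in> A"
      using P Q by (auto intro!: sum_in_subalgebra mult_in_subalgebra A const_in_subalgebra)
    \<comment> \<open>Characteristic zero enters here: the nonzero number \<open>card G\<close> is
      invertible in the field.\<close>
    then have "const (1 / of_nat (card G)) * (?c * transfer G (Poly_Mapping.single m 1)) \<in> A"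
      by (rule mult_in_subalgebra[OF A const_in_subalgebra[OF A]])
    moreover have "card G \<noteq> 0" using finite_G id_in_G by auto
    ultimately show ?thesis
      by (simp add: A_def const_one flip: mult.assoc const_mult)
  qed
qed

text \<open>Up to the invertible factor \<open>card G\<close>, an invariant is its own transfer,
  hence a linear combination of transfers of monomials.\<close>

theorem noether_bound:
  "generated_in_degree (invariants V G :: ('v, 'k :: field_char_0) mpoly set) (card G)"
  unfolding generated_in_degree_def
proof (intro equalityI subsetI[of "invariants V G"])
  show "is_subalgebra hull {p \<in> invariants V G. total_degree p \<le> card G}
      \<subseteq> (invariants V G :: ('v, 'k) mpoly set)"
    by (rule hull_minimal[where S = is_subalgebra]) (auto simp: is_subalgebra_invariants)
next
  fix p :: "('v, 'k) mpoly" assume p: "p \<in> invariants V G"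
  let ?A = "is_subalgebra hull {p \<in> (invariants V G :: ('v, 'k) mpoly set). total_degree p \<le> card G}"
  have "const (of_nat (card G)) * p = transfer G p"
    using p by (simp add: invariants_def transfer_of_invariant)
  also have "\<dots> = transfer G (\<Sum>m\<in>Poly_Mapping.keys p. const (Poly_Mapping.lookup p m) * Poly_Mapping.single m 1)"
    by (simp add: const_def mult_single poly_mapping_sum_single)
  also have "\<dots> = (\<Sum>m\<in>Poly_Mapping.keys p. const (Poly_Mapping.lookup p m) * transfer G (Poly_Mapping.single m 1))"
    by (simp add: transfer_sum transfer_mult_invariant)
  also have "\<dots> \<in> ?A"
    using p by (intro sum_in_subalgebra mult_in_subalgebra is_subalgebra_hull
        const_in_subalgebra transfer_single_in_hull) (auto simp: invariants_def polynomial_ring_def)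
  finally have "const (1 / of_nat (card G)) * (const (of_nat (card G)) * p) \<in> ?A"
    by (rule mult_in_subalgebra[OF is_subalgebra_hull const_in_subalgebra[OF is_subalgebra_hull]])
  moreover have "card G \<noteq> 0" using finite_G id_in_G by auto
  ultimately show "p \<in> ?A"
    by (simp add: const_one flip: mult.assoc const_mult)
qed

end

subsection \<open>Evaluation in the algebraic closure\<close>

definition eval_monomial :: "('v \<Rightarrow> 'r :: comm_semiring_1) \<Rightarrow> 'v monomial \<Rightarrow> 'r" where
  "eval_monomial a m = (\<Prod>x\<in>Poly_Mapping.keys m. a x ^ Poly_Mapping.lookup m x)"

text \<open>Values lie in the algebraic closure because the roots of unity used as coordinates may
  be missing from the field.\<close>

definition eval_poly :: "('v \<Rightarrow> 'k alg_closure) \<Rightarrow> ('v, 'k :: field) mpoly \<Rightarrow> 'k alg_closure" where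
  "eval_poly a p = (\<Sum>m\<in>Poly_Mapping.keys p. to_ac (Poly_Mapping.lookup p m) * eval_monomial a m)"

lemma eval_monomial_superset:
  "finite S \<Longrightarrow> Poly_Mapping.keys m \<subseteq> S \<Longrightarrow> eval_monomial a m = (\<Prod>x\<in>S. a x ^ Poly_Mapping.lookup m x)"
  unfolding eval_monomial_def by (rule prod.mono_neutral_left) (auto simp: in_keys_iff)

lemma eval_monomial_add: "eval_monomial a (m + n) = eval_monomial a m * eval_monomial a n"
proof -
  let ?S = "Poly_Mapping.keys m \<union> Poly_Mapping.keys n"
  have "eval_monomial a k = (\<Prod>x\<in>?S. a x ^ Poly_Mapping.lookup k x)" if "k \<in> {m, n, m + n}" for k
    using that keys_add[of m n] by (intro eval_monomial_superset) auto
  then show ?thesis by (simp add: lookup_add power_add prod.distrib)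
qed

lemma eval_monomial_scale:
  "eval_monomial (\<lambda>x. c * a x) m = c ^ monomial_degree m * eval_monomial a m"
  by (simp add: eval_monomial_def monomial_degree_def power_mult_distrib prod.distrib power_sum)

lemma eval_poly_add: "eval_poly a (p + q) = eval_poly a p + eval_poly a q"
  unfolding eval_poly_def
  by (rule setsum_keys_plus_distrib[where f = "\<lambda>m c. to_ac c * eval_monomial a m"])
    (auto simp: distrib_right)

lemma eval_poly_zero [simp]: "eval_poly a 0 = 0"
  by (simp add: eval_poly_def)

lemma eval_poly_single: "eval_poly a (Poly_Mapping.single m c) = to_ac c * eval_monomial a m"
  unfolding eval_poly_def
  by (rule sum_keys_single[where f = "\<lambda>m c. to_ac c * eval_monomial a m"]) simp

lemma eval_poly_mult: "eval_poly a (p * q) = eval_poly a p * eval_poly a q"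
  by (rule multiplicative_if_on_singles)
    (simp_all add: eval_poly_add eval_poly_single eval_monomial_add)

lemma eval_poly_const [simp]: "eval_poly a (const c) = to_ac c"
  by (simp add: const_def eval_poly_single eval_monomial_def)

lemma eval_poly_var [simp]: "eval_poly a (var x) = a x"
  by (simp add: var_def eval_poly_single eval_monomial_def)

lemma eval_poly_power: "eval_poly a (p ^ k) = eval_poly a p ^ k"
  using eval_poly_const[of a 1] by (induction k) (simp_all add: eval_poly_mult const_one)

lemma eval_poly_sum: "eval_poly a (sum f I) = (\<Sum>i\<in>I. eval_poly a (f i))"
  by (rule additive_sum) (simp_all add: eval_poly_add)

lemma eval_monomial_sum: "eval_monomial a (sum f I) = (\<Prod>i\<in>I. eval_monomial a (f i))"
  by (induction I rule: infinite_finite_induct)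
    (simp_all add: eval_monomial_add eval_monomial_def[of a 0])

lemma eval_monomial_rename: "eval_monomial a (rename_monomial f m) = eval_monomial (a \<circ> f) m"
proof -
  have "eval_monomial a (Poly_Mapping.single x c) = a x ^ c" for x c
    by (simp add: eval_monomial_def)
  then show ?thesis
    by (simp add: rename_monomial_def eval_monomial_sum) (simp add: eval_monomial_def)
qed

lemma eval_poly_rename: "eval_poly a (rename_vars f p) = eval_poly (a \<circ> f) p"
  by (simp add: rename_vars_def eval_poly_sum eval_poly_single eval_monomial_rename)
    (simp add: eval_poly_def)

section \<open>Roots of unity\<close>

definition primitive_root :: "nat \<Rightarrow> 'r :: monoid_mult \<Rightarrow> bool" where
  "primitive_root k z \<longleftrightarrow> z ^ k = 1 \<and> (\<forall>j. 0 < j \<and> j < k \<longrightarrow> z ^ j \<noteq> 1)"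

text \<open>For \<open>e = Suc e'\<close> take \<open>z\<close> with
  \<open>z ^ 2 ^ e' = - 1\<close>. If \<open>z ^ j = 1\<close> with \<open>j = 2 ^ a * b\<close>,
  \<open>b\<close> odd and \<open>a \<le> e'\<close>, raising to the power
  \<open>2 ^ (e' - a)\<close> gives \<open>(- 1) ^ b = 1\<close>, a contradiction.\<close>

lemma exists_primitive_root_power_of_2:
  "\<exists>z :: 'k :: field_char_0 alg_closure. primitive_root (2 ^ e) z"
proof (cases e)
  case 0
  then show ?thesis by (intro exI[of _ 1]) (auto simp: primitive_root_def)
next
  case (Suc e')
  obtain z :: "'k alg_closure" where z: "z ^ 2 ^ e' = - 1"
    using nth_root_exists[of "2 ^ e'" "- 1 :: 'k alg_closure"] by auto
  have neq: "(- 1 :: 'k alg_closure) \<noteq> 1"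
    by (simp add: minus_equation_iff)
  have "z ^ j \<noteq> 1" if j: "0 < j" "j < 2 ^ e" for j
  proof
    assume "z ^ j = 1"
    define a where "a = multiplicity 2 j"
    obtain b where b: "j = 2 ^ a * b" "odd b"
      using j unfolding a_def
      by (metis multiplicity_decompose' less_not_refl not_is_unit_0 zero_neq_numeral odd_one)
    \<comment> \<open>The bound \<open>j < 2 ^ e\<close> is what forces
      \<open>a \<le> e'\<close>.\<close>
    have "2 ^ a \<le> j" using b j by (cases b) auto
    then have "(2 :: nat) ^ a < 2 ^ Suc e'" using j Suc by simp
    then have "a \<le> e'"
      using power_less_imp_less_exp[of "2 :: nat" a "Suc e'"] by simp
    then have "2 ^ e' * b = j * 2 ^ (e' - a)"
      by (simp add: b flip: power_add)
    then have "(- 1) ^ b = (z ^ j) ^ 2 ^ (e' - a)"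
      by (simp flip: z power_mult)
    then show False using \<open>z ^ j = 1\<close> b neq by simp
  qed
  moreover have "z ^ 2 ^ e = 1"
    by (simp add: Suc power_mult z mult.commute[of 2])
  ultimately show ?thesis by (auto simp: primitive_root_def)
qed

text \<open>A geometric sum whose ratio \<open>z ^ d\<close> is a \<open>k\<close>-th root of unity
  other than \<open>1\<close>.\<close>

lemma sum_powers_of_root:
  fixes z :: "'r :: field"
  assumes "z ^ k = 1" "z ^ d \<noteq> 1"
  shows "(\<Sum>i<k. (z ^ i) ^ d) = 0"
proof -
  have "(\<Sum>i<k. (z ^ i) ^ d) = (\<Sum>i<k. (z ^ d) ^ i)"
    by (simp add: mult.commute flip: power_mult)
  moreover have "(z ^ d) ^ k = 1"
    using assms(1) by (metis mult.commute power_mult power_one)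
  ultimately show ?thesis
    using assms(2) by (simp add: geometric_sum)
qed

text \<open>A polynomial fixed by a substitution that multiplies the point \<open>a\<close> by \<open>z\<close> takes the same
  value at all the points \<open>z ^ i * a\<close>; averaging over these kills the degrees strictly between
  \<open>0\<close> and \<open>k\<close>.\<close>

lemma eval_poly_low_degree:
  fixes p :: "('v, 'k :: field_char_0) mpoly"
  assumes z: "primitive_root k z" and k: "k > 0"
    and a: "\<And>x. a (f x) = z * a x"
    and p: "rename_vars f p = p" "total_degree p < k"
  shows "eval_poly a p = eval_poly (\<lambda>_. 0) p"
proof -
  have scaled: "eval_poly (\<lambda>x. z ^ i * a x) p = eval_poly a p" for i
  proof (induction i)
    case (Suc i)
    have "(\<lambda>x. z ^ Suc i * a x) = (\<lambda>x. z ^ i * a x) \<circ> f"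
      by (simp add: fun_eq_iff a mult_ac)
    then show ?case using Suc p(1) by (metis eval_poly_rename)
  qed simp
  have zero: "eval_monomial (\<lambda>_. 0) m = (if monomial_degree m = 0 then 1 else (0 :: 'k alg_closure))"
    for m :: "'v monomial"
    using eval_monomial_scale[of 0 "\<lambda>_. 0 :: 'k alg_closure" m]
    by (auto simp: eval_monomial_def monomial_degree_def in_keys_iff)
  have const: "eval_monomial a m = 1" if "monomial_degree m = 0" for m
    using that by (auto simp: eval_monomial_def monomial_degree_def in_keys_iff)
  have "(\<Sum>i<k. (z ^ i) ^ monomial_degree m) * eval_monomial a m =
      of_nat k * eval_monomial (\<lambda>_. 0) m" if "m \<in> Poly_Mapping.keys p" for m
  proof (cases "monomial_degree m = 0")
    case False
    have "monomial_degree m < k"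
      using that p(2) total_degree_le_iff[of p "total_degree p"] by auto
    with False z have "z ^ k = 1" "z ^ monomial_degree m \<noteq> 1"
      by (auto simp: primitive_root_def)
    then show ?thesis using False by (simp add: sum_powers_of_root zero)
  qed (simp add: zero const)
  then have "(\<Sum>m\<in>Poly_Mapping.keys p. to_ac (Poly_Mapping.lookup p m) *
        ((\<Sum>i<k. (z ^ i) ^ monomial_degree m) * eval_monomial a m)) = of_nat k * eval_poly (\<lambda>_. 0) p"
    by (simp add: eval_poly_def sum_distrib_left mult_ac)
  \<comment> \<open>By homogeneity, \<open>m\<close> gains the factor
    \<open>(z ^ i) ^ monomial_degree m\<close> at the point \<open>z ^ i * a\<close>; by
    \<open>scaled\<close>, the summands on the right are all equal.\<close>
  moreover have "(\<Sum>m\<in>Poly_Mapping.keys p. to_ac (Poly_Mapping.lookup p m) *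
        ((\<Sum>i<k. (z ^ i) ^ monomial_degree m) * eval_monomial a m)) =
      (\<Sum>i<k. eval_poly (\<lambda>x. z ^ i * a x) p)"
    unfolding eval_poly_def eval_monomial_scale
    by (subst sum.swap) (simp add: sum_distrib_left sum_distrib_right mult_ac)
  ultimately have "of_nat k * eval_poly a p = of_nat k * eval_poly (\<lambda>_. 0) p"
    by (simp add: scaled)
  then show ?thesis using k by simp
qed

text \<open>Both evaluations are algebra homomorphisms, so the polynomials on which they agree form
  a subalgebra. It contains the generators, whose degree is less than \<open>k\<close>.\<close>

lemma eval_poly_generated:
  fixes A :: "('v, 'k :: field_char_0) mpoly set"
  assumes z: "primitive_root k z"
    and a: "\<And>x. a (f x) = z * a x"
    and A: "\<And>p. p \<in> A \<Longrightarrow> rename_vars f p = p"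
    and gen: "generated_in_degree A d" "d < k" and p: "p \<in> A"
  shows "eval_poly a p = eval_poly (\<lambda>_. 0) p"
proof -
  let ?E = "{q. eval_poly a q = eval_poly (\<lambda>_. 0) q}"
  have "is_subalgebra ?E"
    by (auto simp: is_subalgebra_def eval_poly_add eval_poly_mult)
  moreover have "{q \<in> A. total_degree q \<le> d} \<subseteq> ?E"
    using A gen(2) by (auto intro!: eval_poly_low_degree[OF z, where f = f] a)
  ultimately have "is_subalgebra hull {q \<in> A. total_degree q \<le> d} \<subseteq> ?E"
    by (rule hull_minimal[where S = is_subalgebra, rotated])
  then show ?thesis using gen(1) p by (auto simp: generated_in_degree_def)
qed

subsection \<open>Graph invariants\<close>

lemma edges_eq: "edges n = {e. e \<subseteq> {1..n} \<and> card e = 2}"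
proof (intro equalityI subsetI)
  fix e assume "e \<in> {e. e \<subseteq> {1..n} \<and> card e = 2}"
  then obtain i j where "e = {i, j}" "i \<noteq> j" "{i, j} \<subseteq> {1..n}"
    by (auto simp: card_2_iff)
  then have "e = {min i j, max i j} \<and> 1 \<le> min i j \<and> min i j < max i j \<and> max i j \<le> n"
    by (auto simp: min_def max_def)
  then show "e \<in> edges n"
    unfolding edges_def by blast
qed (auto simp: edges_def)

lemma finite_edges: "finite (edges n)"
  unfolding edges_eq by (rule finite_subset[of _ "Pow {1..n}"]) auto

lemma image_edge:
  assumes "\<sigma> permutes {1..n}" "e \<in> edges n" shows "\<sigma> ` e \<in> edges n"
  using assms image_mono[of e "{1..n}" \<sigma>]
  by (simp add: edges_eq permutes_image card_image permutes_inj_on)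

lemma bij_betw_image_edges:
  assumes "\<sigma> permutes {1..n}" shows "bij_betw ((`) \<sigma>) (edges n) (edges n)"
proof -
  have "inj_on ((`) \<sigma>) (edges n)"
    using permutes_inj[OF assms] by (auto simp: inj_on_def inj_image_eq_iff)
  then show ?thesis
    using image_edge[OF assms] endo_inj_surj[OF finite_edges]
    by (metis bij_betw_def image_subsetI)
qed

lemma graph_invariants_eq:
  "graph_invariants n = invariants (edges n) ((`) ` {\<sigma>. \<sigma> permutes {1..n}})"
  by (auto simp: graph_invariants_def invariants_def act_def)

text \<open>Passing from a permutation to its image map respects composition, so the group laws are
  inherited from the symmetric group.\<close>

lemma finite_substitution_group_edges:
  "finite_substitution_group (edges n) ((`) ` {\<sigma>. \<sigma> permutes {1..n}})"
proof
  show "finite ((`) ` {\<sigma>. \<sigma> permutes {1..n}})"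
    by (simp add: finite_permutations)
  show "id \<in> (`) ` {\<sigma>. \<sigma> permutes {1..n}}"
    by (rule image_eqI[of _ _ id]) (auto simp: fun_eq_iff permutes_id)
  fix g assume g: "g \<in> (`) ` {\<sigma>. \<sigma> permutes {1..n}}"
  then obtain \<sigma> where \<sigma>: "g = (`) \<sigma>" "\<sigma> permutes {1..n}" by blast
  show "\<exists>h\<in>(`) ` {\<sigma>. \<sigma> permutes {1..n}}. g \<circ> h = id"
    using \<sigma> permutes_inv[OF \<sigma>(2)] permutes_inv_o(1)[OF \<sigma>(2)]
    by (intro bexI[of _ "(`) (inv_into UNIV \<sigma>)"]) (auto simp: fun_eq_iff image_comp)
  show "g x \<in> edges n" if "x \<in> edges n" for x
    using \<sigma> that image_edge by blast
  fix h assume "h \<in> (`) ` {\<sigma>. \<sigma> permutes {1..n}}"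
  then obtain \<tau> where \<tau>: "h = (`) \<tau>" "\<tau> permutes {1..n}" by blast
  show "g \<circ> h \<in> (`) ` {\<sigma>. \<sigma> permutes {1..n}}"
    using \<sigma> \<tau> permutes_compose by (intro image_eqI[of _ _ "\<sigma> \<circ> \<tau>"]) (auto simp: image_comp)
qed

text \<open>A permutation of the vertices permutes the edges and hence the summands.\<close>

lemma power_sum_in_graph_invariants: "(\<Sum>e\<in>edges n. var e ^ k) \<in> graph_invariants n"
proof -
  have "rename_vars ((`) \<sigma>) (\<Sum>e\<in>edges n. var e ^ k) = (\<Sum>e\<in>edges n. var e ^ k)"
    if "\<sigma> permutes {1..n}" for \<sigma>
    unfolding rename_vars_sum rename_vars_power rename_vars_var
    by (rule sum.reindex_bij_betw[OF bij_betw_image_edges[OF that], where g = "\<lambda>e. var e ^ k"])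
  then show ?thesis
    by (auto simp: graph_invariants_def act_def intro!: sum_in_subalgebra power_in_subalgebra
        is_subalgebra_polynomial_ring var_in_polynomial_ring)
qed

section \<open>Rotation of a star\<close>

definition cyclic_shift :: "nat \<Rightarrow> nat \<Rightarrow> nat" where
  "cyclic_shift k i = (if i \<in> {1..<k} then i + 1 else if i = k then 1 else i)"

lemma cyclic_shift_permutes:
  assumes "k > 0" shows "cyclic_shift k permutes {1..k}"
proof (rule bij_imp_permutes)
  have "inj_on (cyclic_shift k) {1..k}"
    by (auto simp: inj_on_def cyclic_shift_def split: if_splits)
  moreover have "cyclic_shift k ` {1..k} \<subseteq> {1..k}"
    using assms by (auto simp: cyclic_shift_def)
  ultimately show "bij_betw (cyclic_shift k) {1..k} {1..k}"
    by (simp add: bij_betw_def endo_inj_surj)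
  show "cyclic_shift k i = i" if "i \<notin> {1..k}" for i
    using that assms by (auto simp: cyclic_shift_def)
qed

text \<open>The weight \<open>z ^ i\<close> on the \<open>i\<close>-th edge of the star with center \<open>k + 1\<close> and leaves \<open>1..k\<close>,
  and \<open>0\<close> on all other edges.\<close>

definition star_point :: "nat \<Rightarrow> 'r :: comm_semiring_1 \<Rightarrow> nat set \<Rightarrow> 'r" where
  "star_point k z e = (\<Sum>i\<in>{1..k}. if e = {i, k + 1} then z ^ i else 0)"

text \<open>The rotation fixes the center and moves each leaf to the next, which multiplies the
  weight by \<open>z\<close>. Being injective, it keeps everything outside the star outside, where
  the weight is \<open>0\<close>.\<close>

lemma star_point_shift:
  assumes "k > 0" "z ^ k = 1"
  shows "star_point k z (cyclic_shift k ` e) = z * star_point k z e"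
proof -
  let ?s = "cyclic_shift k"
  have s: "?s permutes {1..k}" by (rule cyclic_shift_permutes) fact
  have center: "?s (k + 1) = k + 1" by (simp add: cyclic_shift_def)
  have "star_point k z (?s ` e) =
      (\<Sum>i\<in>{1..k}. if ?s ` e = {?s i, k + 1} then z ^ ?s i else 0)"
    unfolding star_point_def
    by (rule sum.reindex_bij_betw[OF permutes_imp_bij[OF s], symmetric,
          where g = "\<lambda>i. if ?s ` e = {i, k + 1} then z ^ i else 0"])
  also have "\<dots> = (\<Sum>i\<in>{1..k}. if e = {i, k + 1} then z * z ^ i else 0)"
  proof (rule sum.cong)
    fix i assume i: "i \<in> {1..k}"
    \<comment> \<open>For \<open>i = k\<close> the shift wraps around to \<open>1\<close>, and
      \<open>z ^ 1 = z * z ^ k\<close>.\<close>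
    have pow: "z ^ ?s i = z * z ^ i"
      using i assms by (auto simp: cyclic_shift_def)
    have "?s ` e = {?s i, k + 1} \<longleftrightarrow> ?s ` e = ?s ` {i, k + 1}"
      by (simp only: image_insert image_empty center)
    also have "\<dots> \<longleftrightarrow> e = {i, k + 1}"
      by (rule inj_image_eq_iff[OF permutes_inj[OF s]])
    finally show "(if ?s ` e = {?s i, k + 1} then z ^ ?s i else 0) =
        (if e = {i, k + 1} then z * z ^ i else 0)"
      by (simp only: pow)
  qed simp
  also have "\<dots> = z * star_point k z e"
    by (auto simp: star_point_def sum_distrib_left intro!: sum.cong)
  finally show ?thesis .
qed

text \<open>\<open>k < n\<close> makes the center \<open>k + 1\<close> a vertex. Each edge of the
  star contributes \<open>(z ^ i) ^ k = 1\<close>, every other edge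
  \<open>0 ^ k = 0\<close>.\<close>

lemma sum_star_point_power:
  assumes "k < n" "k > 0" "z ^ k = 1"
  shows "(\<Sum>e\<in>edges n. star_point k z e ^ k) = of_nat k"
proof -
  let ?E = "(\<lambda>i. {i, k + 1}) ` {1..k}"
  have inj: "inj_on (\<lambda>i. {i, k + 1}) {1..k}"
    by (auto simp: inj_on_def doubleton_eq_iff)
  have weight: "star_point k z {i, k + 1} = z ^ i" if "i \<in> {1..k}" for i
  proof -
    have "star_point k z {i, k + 1} = (\<Sum>j\<in>{1..k}. if i = j then z ^ j else 0)"
      unfolding star_point_def using that by (intro sum.cong) (auto simp: doubleton_eq_iff)
    then show ?thesis using that by simp
  qed
  have root: "(z ^ i) ^ k = 1" for i
    using assms(3) by (metis mult.commute power_mult power_one)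
  have "(\<Sum>e\<in>edges n. star_point k z e ^ k) = (\<Sum>e\<in>?E. star_point k z e ^ k)"
  proof (rule sum.mono_neutral_right[OF finite_edges])
    show "?E \<subseteq> edges n" using assms by (auto simp: edges_eq)
    show "\<forall>e\<in>edges n - ?E. star_point k z e ^ k = 0"
      using assms by (auto simp: star_point_def image_iff zero_power intro!: sum.neutral)
  qed
  also have "\<dots> = (\<Sum>i\<in>{1..k}. (z ^ i) ^ k)"
    unfolding sum.reindex[OF inj] using weight by simp
  also have "\<dots> = of_nat k"
    using root by simp
  finally show ?thesis .
qed

section \<open>The lower bound\<close>

lemma graph_invariants_generating_degree:
  assumes gen: "generated_in_degree (graph_invariants n :: (nat set, 'k :: field_char_0) mpoly set) d"
    and k: "2 ^ e < n"
  shows "2 ^ e \<le> d"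
proof (rule ccontr)
  assume less: "\<not> 2 ^ e \<le> d"
  define k :: nat where "k = 2 ^ e"
  have pos: "k > 0" by (simp add: k_def)
  obtain z :: "'k alg_closure" where z: "primitive_root k z"
    unfolding k_def using exists_primitive_root_power_of_2 by blast
  then have zk: "z ^ k = 1" by (simp add: primitive_root_def)
  let ?p = "\<Sum>e\<in>edges n. var e ^ k :: (nat set, 'k) mpoly"
  \<comment> \<open>The rotation fixes all vertices above \<open>k\<close>, so it is one of the
    permutations that graph invariants are invariant under.\<close>
  have "cyclic_shift k permutes {1..n}"
    using cyclic_shift_permutes[OF pos] by (rule permutes_subset) (use k in \<open>auto simp: k_def\<close>)
  then have "rename_vars ((`) (cyclic_shift k)) p = p" if "p \<in> graph_invariants n"
    for p :: "(nat set, 'k) mpoly"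
    using that by (simp add: graph_invariants_def act_def)
  moreover have "d < k" using less by (simp add: k_def)
  ultimately have "eval_poly (star_point k z) ?p = eval_poly (\<lambda>_. 0) ?p"
    using eval_poly_generated[OF z, of "star_point k z" "(`) (cyclic_shift k)"]
      star_point_shift[OF pos zk] gen power_sum_in_graph_invariants by blast
  then have "of_nat k = (0 :: 'k alg_closure)"
    using k pos zk by (simp add: eval_poly_sum eval_poly_power sum_star_point_power k_def)
  then show False using pos by simp
qed

theorem corollary8p2:
  fixes n :: nat
  assumes "n \<ge> 1"
  shows "beta (graph_invariants n :: (nat set, 'k :: field_char_0) mpoly set) \<ge> n div 2"
proof (cases "n = 1")
  case False
  let ?I = "graph_invariants n :: (nat set, 'k) mpoly set"
  \<comment> \<open>The least degree is attained because Noether's bound supplies a degree that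
    generates.\<close>
  have "generated_in_degree ?I (beta ?I)"
    unfolding beta_def graph_invariants_eq
    by (rule LeastI, rule finite_substitution_group.noether_bound)
      (rule finite_substitution_group_edges)
  moreover have "1 \<le> n - 1" using assms False by simp
  \<comment> \<open>\<open>2 ^ e\<close> is the largest power of two strictly below
    \<open>n\<close>, which leaves a vertex for the center. Then \<open>n \<le> 2 ^ (e + 1)\<close>,
    hence \<open>n div 2 \<le> 2 ^ e\<close>.\<close>
  then obtain e where e: "2 ^ e \<le> n - 1" "n - 1 < 2 ^ (e + 1)"
    using ex_power_ivl1[of 2 "n - 1"] by auto
  ultimately have "2 ^ e \<le> beta ?I"
    using assms by (intro graph_invariants_generating_degree) auto
  with e show ?thesis by simp
\<comment> \<open>For \<open>n = 1\<close> the claimed bound is \<open>0\<close>.\<close>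
qed simp

end
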